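(* Consider the nonlinear system $\dot x=f(x)+Bu+Ed$ with $x\in\mathbb R^n$, $u\in\mathbb R^m$, disturbance $d\in\mathbb R^q$, $E\in\mathbb R^{n\times q}$ known, and $f(x)=AZ(x)$, where $A\in\mathbb R^{n\times s}$, $B\in\mathbb R^{n\times m}$ and $Z(x)=\begin{bmatrix} x \\ Q(x) \end{bmatrix}$, with $Z:\mathbb R^n\to\mathbb R^s$ continuously differentiable and $Q:\mathbb R^n\to\mathbb R^{s-n}$ containing only nonlinear functions. Let $U_0,X_1,Z_0,D_0$ be the data matrices described in the context (with $D_0$ unknown), and assume that, for a given matrix $\Delta$ with $q$ rows, $D_0\in\mathcal D:=\{D\in\mathbb R^{q\times T}: DD^\top\preceq\Delta\Delta^\top\}$. Let $R_Q\in\mathbb R^{n\times\tau}$ be a matrix and $\mathcal X\subseteq\mathbb R^n$ a set such that $\frac{\partial Q}{\partial x}(x)^\top\frac{\partial Q}{\partial x}(x)\preceq R_QR_Q^\top$ for any $x\in\mathcal X$. Consider the following semidefinite program in the decision variables $P\in\mathbb S^{n\times n}$, $Y_1\in\mathbb R^{T\times n}$, $G_2\in\mathbb R^{T\times(s-n)}$, $\alpha\in\mathbb R_{>0}$, $\mu\in\mathbb R_{>0}$: $$P\succ0,\qquad Z_0Y_1=\begin{bmatrix} P \\ 0_{(s-n)\times n} \end{bmatrix},$$ $$\begin{bmatrix} M(Y_1,\alpha,\mu) & \star & \star & \star \\ G_2^\top X_1^\top & -I_{s-n} & \star & \star \\ R_Q^\top P & 0_{\tau\times(s-n)} & -I_\tau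 & \star \\ Y_1 & G_2 & 0_{T\times\tau} & -\mu I_T \end{bmatrix}\preceq0,$$ $$Z_0G_2=\begin{bmatrix} 0_{n\times(s-n)} \\ I_{s-n} \end{bmatrix},$$ where $M(Y_1,\alpha,\mu):=X_1Y_1+(X_1Y_1)^\top+\alpha I_n+\mu E\Delta\Delta^\top E^\top$. If the program is feasible, then the control law $u=KZ(x)$ with $K=U_0\begin{bmatrix} Y_1P^{-1} & G_2 \end{bmatrix}$ is such that the closed-loop dynamics $\dot x=(A+BK)Z(x)+Ed$ are exponentially contractive on $\mathcal X$, i.e., there exist $P\in\mathbb S^{n\times n}$, $P\succ0$, and $\beta>0$ such that for all $x\in\mathcal X$ $$\Big((A+BK)\frac{\partial Z(x)}{\partial x}\Big)^\top P^{-1}+P^{-1}(A+BK)\frac{\partial Z(x)}{\partial x}\preceq-\beta P^{-1}.$$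
   Context: $\mathbb S^{n\times n}$ is the set of real symmetric $n\times n$ matrices; $\succ,\succeq,\prec,\preceq$ refer to (semi)definiteness; $\star$ denotes entries determined by symmetry of the block matrix. The matrices $A,B$ are unknown to the designer, while $Z$ and $E$ are known. Data: for an integer $T>0$ and distinct sampling times $t_0<\dots<t_{T-1}$, samples $x_i=x(t_i)$, $u_i=u(t_i)$, $\dot x_i=\dot x(t_i)$, $d_i=d(t_i)$ satisfying $\dot x_i=AZ(x_i)+Bu_i+Ed_i$, $i=0,\dots,T-1$, are collected in $$U_0=[u_0\ \cdots\ u_{T-1}]\in\mathbb R^{m\times T},\quad X_1=[\dot x_0\ \cdots\ \dot x_{T-1}]\in\mathbb R^{n\times T},\quad Z_0=[Z(x_0)\ \cdots\ Z(x_{T-1})]\in\mathbb R^{s\times T},\quad D_0=[d_0\ \cdots\ d_{T-1}]\in\mathbb R^{q\times T},$$ so that $X_1=AZ_0+BU_0+ED_0$. *)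

theory Defs
  imports "HOL-Analysis.Analysis"
begin

text \<open>
  A real matrix with rows indexed by \<open>'a\<close> and columns indexed by \<open>'b\<close> has type
  \<open>real^'b^'a\<close>.  Block vectors and block matrices are indexed by sum types, so that the
  dimension \<open>s\<close> of \<open>Z(x) = (x, Q(x))\<close> is represented by \<open>'n + 'r\<close>, with \<open>'r\<close> standing for
  \<open>s - n\<close>.
\<close>

definition stack_vec :: "real^'a \<Rightarrow> real^'b \<Rightarrow> real^('a + 'b)" where
  "stack_vec v w = (\<chi> i. case i of Inl a \<Rightarrow> v $ a | Inr b \<Rightarrow> w $ b)"

definition hcat :: "real^'b^'a \<Rightarrow> real^'c^'a \<Rightarrow> real^('b + 'c)^'a"  (infixr "|||" 55) where
  "M ||| N = (\<chi> i. stack_vec (M $ i) (N $ i))"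

definition vcat :: "real^'c^'a \<Rightarrow> real^'c^'b \<Rightarrow> real^'c^('a + 'b)"  (infixr "===" 54) where
  "M === N = (\<chi> i. case i of Inl a \<Rightarrow> M $ a | Inr b \<Rightarrow> N $ b)"

text \<open>The symmetric block matrix given by its lower triangle (with symmetric diagonal blocks);
  the blocks above the diagonal are those written \<open>\<star>\<close>.\<close>

definition sym_blocks4 ::
  "real^'a^'a \<Rightarrow>
   real^'a^'b \<Rightarrow> real^'b^'b \<Rightarrow>
   real^'a^'c \<Rightarrow> real^'b^'c \<Rightarrow> real^'c^'c \<Rightarrow>
   real^'a^'d \<Rightarrow> real^'b^'d \<Rightarrow> real^'c^'d \<Rightarrow> real^'d^'d \<Rightarrow>
   real^('a + 'b + 'c + 'd)^('a + 'b + 'c + 'd)" where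
  "sym_blocks4 M11 M21 M22 M31 M32 M33 M41 M42 M43 M44 =
    (M11 ||| transpose M21 ||| transpose M31 ||| transpose M41) ===
    (M21 |||           M22 ||| transpose M32 ||| transpose M42) ===
    (M31 |||           M32 |||           M33 ||| transpose M43) ===
    (M41 |||           M42 |||           M43 |||           M44)"

definition symmetric_mat :: "real^'a^'a \<Rightarrow> bool" where
  "symmetric_mat M \<longleftrightarrow> transpose M = M"

definition pos_def :: "real^'a^'a \<Rightarrow> bool" where
  "pos_def M \<longleftrightarrow> symmetric_mat M \<and> (\<forall>v. v \<noteq> 0 \<longrightarrow> 0 < v \<bullet> (M *v v))"

definition pos_semidef :: "real^'a^'a \<Rightarrow> bool" where
  "pos_semidef M \<longleftrightarrow> symmetric_mat M \<and> (\<forall>v. 0 \<le> v \<bullet> (M *v v))"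

definition loewner_le :: "real^'a^'a \<Rightarrow> real^'a^'a \<Rightarrow> bool"  (infix "\<preceq>" 50) where
  "M \<preceq> N \<longleftrightarrow> pos_semidef (N - M)"

definition continuously_differentiable :: "(real^'a \<Rightarrow> real^'b) \<Rightarrow> bool" where
  "continuously_differentiable g \<longleftrightarrow>
    (\<forall>x. g differentiable (at x)) \<and> continuous_on UNIV (\<lambda>x. jacobian g (at x))"

text \<open>The matrix whose columns are the samples \<open>g (t i)\<close>.\<close>

definition sample_matrix :: "('T \<Rightarrow> real) \<Rightarrow> (real \<Rightarrow> real^'a) \<Rightarrow> real^'T^'a" where
  "sample_matrix t g = transpose (\<chi> i. g (t i))"

definition disturbance_set :: "real^'p^'q \<Rightarrow> (real^'T^'q) set" where
  "disturbance_set \<Delta> = {D. D ** transpose D \<preceq> \<Delta> ** transpose \<Delta>}"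

definition lmi_M ::
  "real^'T^'n \<Rightarrow> real^'q^'n \<Rightarrow> real^'p^'q \<Rightarrow> real^'n^'T \<Rightarrow> real \<Rightarrow> real \<Rightarrow> real^'n^'n" where
  "lmi_M X\<^sub>1 E \<Delta> Y\<^sub>1 \<alpha> \<mu> =
    X\<^sub>1 ** Y\<^sub>1 + transpose (X\<^sub>1 ** Y\<^sub>1) + \<alpha> *\<^sub>R mat 1
      + \<mu> *\<^sub>R (E ** \<Delta> ** transpose \<Delta> ** transpose E)"

definition sdp_feasible ::
  "real^'T^('n + 'r) \<Rightarrow> real^'T^'n \<Rightarrow> real^'q^'n \<Rightarrow> real^'p^'q \<Rightarrow> real^'\<tau>^'n \<Rightarrow>
   real^'n^'n \<Rightarrow> real^'n^'T \<Rightarrow> real^'r^'T \<Rightarrow> real \<Rightarrow> real \<Rightarrow> bool" where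
  "sdp_feasible Z\<^sub>0 X\<^sub>1 E \<Delta> R\<^sub>Q P Y\<^sub>1 G\<^sub>2 \<alpha> \<mu> \<longleftrightarrow>
    0 < \<alpha> \<and> 0 < \<mu> \<and> pos_def P \<and>
    Z\<^sub>0 ** Y\<^sub>1 = (P === 0) \<and>
    sym_blocks4
      (lmi_M X\<^sub>1 E \<Delta> Y\<^sub>1 \<alpha> \<mu>)
      (transpose G\<^sub>2 ** transpose X\<^sub>1)  (- mat 1)
      (transpose R\<^sub>Q ** P)              0          (- mat 1)
      Y\<^sub>1                               G\<^sub>2         0          (- (\<mu> *\<^sub>R mat 1))
      \<preceq> 0 \<and>
    Z\<^sub>0 ** G\<^sub>2 = (0 === mat 1)"

end

theory Submission
  imports Defs
begin

text \<open>
  The constraints on \<open>Z\<^sub>0 Y\<^sub>1\<close> and \<open>Z\<^sub>0 G\<^sub>2\<close> say that \<open>Z\<^sub>0 [Y\<^sub>1 P\<inverse>, G\<^sub>2] = I\<close>, so that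
  \<open>A + B K = (X\<^sub>1 - E D\<^sub>0) [Y\<^sub>1 P\<inverse>, G\<^sub>2]\<close>.  For \<open>v = P w\<close> and \<open>h = (\<partial>Q/\<partial>x) v\<close>, the quadratic form
  of the linear matrix inequality is evaluated at \<open>(w, h, R\<^sub>Q\<^sup>T v, - D\<^sub>0\<^sup>T E\<^sup>T w)\<close>.  The third
  component turns the bound on \<open>\<partial>Q/\<partial>x\<close> into the cancellation of \<open>- \<bar>h\<bar>\<^sup>2\<close>, the fourth replaces
  \<open>X\<^sub>1\<close> by \<open>X\<^sub>1 - E D\<^sub>0\<close> at the price of \<open>\<mu> \<bar>D\<^sub>0\<^sup>T E\<^sup>T w\<bar>\<^sup>2 \<le> \<mu> \<bar>\<Delta>\<^sup>T E\<^sup>T w\<bar>\<^sup>2\<close>.  What remains is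
  \<open>2 w \<bullet> (A + B K) (\<partial>Z/\<partial>x) v \<le> - \<alpha> \<bar>w\<bar>\<^sup>2\<close>, and \<open>\<bar>w\<bar>\<^sup>2\<close> dominates a multiple of
  \<open>w \<bullet> P w = v \<bullet> P\<inverse> v\<close>.
\<close>

section \<open>Inner products, block matrices and quadratic forms\<close>

lemma inner_matrix_vector_transpose:
  fixes M :: "real^'b^'a"
  shows "v \<bullet> (M *v w) = (transpose M *v v) \<bullet> w"
  by (simp add: dot_lmul_matrix[symmetric])

text \<open>Turns semidefinite bounds between Gram matrices, such as those on the disturbance and on
  the Jacobian, into comparisons of squared norms.\<close>

lemma inner_gram:
  fixes M :: "real^'b^'a"
  shows "v \<bullet> ((M ** transpose M) *v v) = (transpose M *v v) \<bullet> (transpose M *v v)"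
  by (simp add: matrix_vector_mul_assoc[symmetric] inner_matrix_vector_transpose)

lemma transpose_add: "transpose (M + N) = transpose M + transpose (N :: real^'b^'a)"
  by (simp add: transpose_def vec_eq_iff)

lemma transpose_diff: "transpose (M - N) = transpose M - transpose (N :: real^'b^'a)"
  by (simp add: transpose_def vec_eq_iff)

lemma transpose_uminus: "transpose (- M) = - transpose (M :: real^'b^'a)"
  by (simp add: transpose_def vec_eq_iff)

lemma uminus_matrix_vector_mult: "(- M) *v v = - (M *v (v :: real^'b))"
  by (simp add: matrix_vector_mult_def vec_eq_iff sum_negf)

lemma sum_UNIV_Plus:
  fixes g :: "'a::finite + 'b::finite \<Rightarrow> 'c::comm_monoid_add"
  shows "(\<Sum>i\<in>UNIV. g i) = (\<Sum>a\<in>UNIV. g (Inl a)) + (\<Sum>b\<in>UNIV. g (Inr b))"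
  by (simp add: UNIV_Plus_UNIV[symmetric] sum.Plus del: UNIV_Plus_UNIV)

lemma inner_stack_vec: "stack_vec v w \<bullet> stack_vec v' w' = v \<bullet> v' + w \<bullet> w'"
  by (simp add: inner_vec_def stack_vec_def sum_UNIV_Plus)

lemma stack_vec_add: "stack_vec v w + stack_vec v' w' = stack_vec (v + v') (w + w')"
  by (simp add: stack_vec_def vec_eq_iff split: sum.splits)

lemma hcat_mult_stack_vec: "(M ||| N) *v stack_vec v w = M *v v + N *v w"
  by (simp add: matrix_vector_mult_def hcat_def stack_vec_def vec_eq_iff sum_UNIV_Plus)

lemma vcat_mult_vec: "(M === N) *v v = stack_vec (M *v v) (N *v v)"
  by (simp add: matrix_vector_mult_def vcat_def stack_vec_def vec_eq_iff split: sum.splits)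

lemma sample_matrix_mult: "sample_matrix t (\<lambda>\<theta>. M *v g \<theta>) = M ** sample_matrix t g"
  by (simp add: sample_matrix_def transpose_def matrix_vector_mult_def matrix_matrix_mult_def
      vec_eq_iff)

lemma sample_matrix_add:
  "sample_matrix t (\<lambda>\<theta>. g \<theta> + h \<theta>) = sample_matrix t g + sample_matrix t h"
  by (simp add: sample_matrix_def transpose_def vec_eq_iff)

text \<open>The form \<open>0 - M\<close> is what \<open>M \<preceq> 0\<close> unfolds to.\<close>

lemma pos_semidef_uminus_iff_quadratic:
  "pos_semidef (0 - M) \<longleftrightarrow> symmetric_mat M \<and> (\<forall>v. v \<bullet> (M *v v) \<le> 0)"
  by (simp add: pos_semidef_def symmetric_mat_def transpose_uminus uminus_matrix_vector_mult)

lemma loewner_le_quadratic: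
  assumes "M \<preceq> N"
  shows "v \<bullet> (M *v v) \<le> v \<bullet> (N *v v)"
  using assms
  by (simp add: loewner_le_def pos_semidef_def matrix_vector_mult_diff_rdistrib inner_diff_right)

text \<open>Each block above the diagonal is the transpose of its mirror image, so the mixed terms
  coincide in pairs; hence the factor 2.\<close>

lemma sym_blocks4_quadratic:
  "stack_vec w (stack_vec h (stack_vec r p)) \<bullet>
     (sym_blocks4 M11 M21 M22 M31 M32 M33 M41 M42 M43 M44 *v
       stack_vec w (stack_vec h (stack_vec r p))) =
    w \<bullet> (M11 *v w) + h \<bullet> (M22 *v h) + r \<bullet> (M33 *v r) + p \<bullet> (M44 *v p)
    + 2 * (h \<bullet> (M21 *v w) + r \<bullet> (M31 *v w) + r \<bullet> (M32 *v h)
         + p \<bullet> (M41 *v w) + p \<bullet> (M42 *v h) + p \<bullet> (M43 *v r))"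
proof -
  have tr: "a \<bullet> (transpose M *v b) = b \<bullet> (M *v a)" for a b and M :: "real^'x^'y"
    by (metis inner_commute inner_matrix_vector_transpose transpose_transpose)
  show ?thesis
    by (simp only: sym_blocks4_def vcat_mult_vec hcat_mult_stack_vec inner_stack_vec
        inner_add_right tr) (simp add: algebra_simps)
qed

section \<open>Inverses and bounds of quadratic forms\<close>

lemma pos_def_invertible:
  assumes "pos_def P"
  shows "invertible P"
proof -
  have "v = 0" if "P *v v = 0" for v
    using assms that unfolding pos_def_def by force
  then show ?thesis
    by (simp add: invertible_left_inverse matrix_left_invertible_ker)
qed

lemma matrix_inv_inverse:
  assumes "invertible P"
  shows matrix_inv_right: "P ** matrix_inv P = mat 1"
    and matrix_inv_left: "matrix_inv P ** P = mat 1"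
  using someI_ex[OF assms[unfolded invertible_def]] by (simp_all add: matrix_inv_def)

text \<open>Transposing \<open>P ** matrix_inv P = mat 1\<close> shows that
  \<open>transpose (matrix_inv P)\<close> is a left inverse of \<open>P\<close>, and a left inverse
  equals the right inverse.\<close>

lemma matrix_inv_symmetric:
  fixes P :: "real^'n^'n"
  assumes "invertible P" "transpose P = P"
  shows "transpose (matrix_inv P) = matrix_inv P"
proof -
  have inv: "P ** matrix_inv P = mat 1" "matrix_inv P ** P = mat 1"
    using assms(1) by (auto simp: matrix_inv_right matrix_inv_left)
  have "transpose (matrix_inv P) ** P = mat 1"
    using inv(1) assms(2) by (metis matrix_transpose_mul transpose_mat)
  then show ?thesis
    by (metis inv(1) matrix_mul_assoc matrix_mul_lid matrix_mul_rid)
qed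

text \<open>The operator bound of \<open>P\<close> and Cauchy-Schwarz give \<open>c\<close>, which
  stands in for the largest eigenvalue.\<close>

lemma quadratic_form_bounded:
  fixes P :: "real^'n^'n"
  obtains c where "0 < c" "\<And>w. w \<bullet> (P *v w) \<le> c * (w \<bullet> w)"
proof -
  obtain c where c: "0 < c" "\<And>w. norm (P *v w) \<le> norm w * c"
    using bounded_linear.pos_bounded[OF matrix_vector_mul_bounded_linear[of P]] by blast
  have "w \<bullet> (P *v w) \<le> c * (w \<bullet> w)" for w
  proof -
    have "w \<bullet> (P *v w) \<le> norm w * norm (P *v w)"
      by (rule norm_cauchy_schwarz)
    also have "\<dots> \<le> norm w * (norm w * c)"
      by (rule mult_left_mono[OF c(2)]) simp
    finally show ?thesis
      by (simp add: dot_square_norm power2_eq_square mult_ac)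
  qed
  with c(1) show ?thesis by (rule that)
qed

section \<open>The Jacobian of the stacked map\<close>

text \<open>Projecting \<open>Z\<close> linearly onto its second block makes \<open>Q\<close>
  differentiable; uniqueness of the derivative then identifies the Jacobian of
  \<open>Z\<close>.\<close>

lemma jacobian_stack_vec:
  fixes Z :: "real^'n \<Rightarrow> real^('n::finite + 'r::finite)"
  assumes Z: "\<And>\<xi>. Z \<xi> = stack_vec \<xi> (Q \<xi>)"
    and diff: "Z differentiable (at \<xi>)"
  shows "jacobian Z (at \<xi>) *v v = stack_vec v (jacobian Q (at \<xi>) *v v)"
proof -
  define L where "L = ((0 ||| mat 1) :: real^('n + 'r)^'r)"
  have "Q = (\<lambda>\<xi>. L *v Z \<xi>)"
    by (simp add: L_def Z hcat_mult_stack_vec fun_eq_iff)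
  moreover have "(\<lambda>\<xi>. L *v Z \<xi>) differentiable (at \<xi>)"
    using diff unfolding differentiable_def
    by (blast intro: bounded_linear.has_derivative[OF matrix_vector_mul_bounded_linear])
  ultimately have "(Q has_derivative (\<lambda>h. jacobian Q (at \<xi>) *v h)) (at \<xi>)"
    by (simp add: jacobian_works)
  \<comment> \<open>As a sum of two linear maps, stacking is open to the usual derivative
    rules.\<close>
  moreover have split: "stack_vec y z = ((mat 1 === 0) :: real^'n^('n + 'r)) *v y
      + ((0 === mat 1) :: real^'r^('n + 'r)) *v z" for y z
    by (simp add: vcat_mult_vec stack_vec_add)
  ultimately have "((\<lambda>\<xi>. stack_vec \<xi> (Q \<xi>)) has_derivative
      (\<lambda>h. stack_vec h (jacobian Q (at \<xi>) *v h))) (at \<xi>)"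
    unfolding split
    by (intro has_derivative_add
        bounded_linear.has_derivative[OF matrix_vector_mul_bounded_linear] has_derivative_ident)
  then have "(Z has_derivative (\<lambda>h. stack_vec h (jacobian Q (at \<xi>) *v h))) (at \<xi>)"
    using Z by (metis (no_types, lifting) ext)
  then show ?thesis
    using diff has_derivative_unique[of Z _ \<xi>] jacobian_works by metis
qed

section \<open>From the linear matrix inequality to contraction\<close>

text \<open>The contraction estimate at one point, with \<open>J\<close> for the Jacobian of
  \<open>Q\<close> there. Using \<open>w\<close> in place of \<open>v = P w\<close> keeps the
  inverse of \<open>P\<close> out of the computation.\<close>

lemma sdp_feasible_decay:
  fixes E :: "real^'q^'n" and Z\<^sub>0 :: "real^'T^('n::finite + 'r::finite)"
    and D\<^sub>0 :: "real^'T^'q" and J :: "real^'n^'r"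
  assumes feasible: "sdp_feasible Z\<^sub>0 X\<^sub>1 E \<Delta> R\<^sub>Q P Y\<^sub>1 G\<^sub>2 \<alpha> \<mu>"
    and D\<^sub>0: "D\<^sub>0 \<in> disturbance_set \<Delta>"
    and J: "transpose J ** J \<preceq> R\<^sub>Q ** transpose R\<^sub>Q"
  shows "2 * (w \<bullet> ((X\<^sub>1 - E ** D\<^sub>0) *v (Y\<^sub>1 *v w + G\<^sub>2 *v (J *v (P *v w))))) \<le> - \<alpha> * (w \<bullet> w)"
proof -
  define h where "h = J *v (P *v w)"
  define r where "r = transpose R\<^sub>Q *v (P *v w)"
  define e where "e = transpose E *v w"
  \<comment> \<open>The sign makes the cross term \<open>p \<bullet> y\<close> supply exactly the
    correction from \<open>X\<^sub>1\<close> to \<open>X\<^sub>1 - E ** D\<^sub>0\<close>.\<close>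
  define p where "p = - (transpose D\<^sub>0 *v e)"
  define y where "y = Y\<^sub>1 *v w + G\<^sub>2 *v h"
  have \<mu>: "0 < \<mu>"
    using feasible by (simp add: sdp_feasible_def)
  have hr: "h \<bullet> h \<le> r \<bullet> r"
    using loewner_le_quadratic[OF J, of "P *v w"] inner_gram[of "P *v w" "transpose J"]
    by (simp add: inner_gram h_def r_def)
  have D: "p \<bullet> p \<le> (transpose \<Delta> *v e) \<bullet> (transpose \<Delta> *v e)"
    using D\<^sub>0 loewner_le_quadratic[of "D\<^sub>0 ** transpose D\<^sub>0" "\<Delta> ** transpose \<Delta>" e]
    by (simp add: disturbance_set_def inner_gram p_def)
  have XY: "w \<bullet> (transpose (X\<^sub>1 ** Y\<^sub>1) *v w) = w \<bullet> (X\<^sub>1 *v (Y\<^sub>1 *v w))"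
    by (metis inner_commute inner_matrix_vector_transpose matrix_vector_mul_assoc)
  have ED: "w \<bullet> ((E ** \<Delta> ** transpose \<Delta> ** transpose E) *v w)
      = (transpose \<Delta> *v e) \<bullet> (transpose \<Delta> *v e)"
    by (simp add: e_def matrix_vector_mul_assoc[symmetric] inner_matrix_vector_transpose
        del: matrix_vector_mul_assoc transpose_matrix_vector)
  have M: "w \<bullet> (lmi_M X\<^sub>1 E \<Delta> Y\<^sub>1 \<alpha> \<mu> *v w) = 2 * (w \<bullet> (X\<^sub>1 *v (Y\<^sub>1 *v w))) + \<alpha> * (w \<bullet> w)
      + \<mu> * ((transpose \<Delta> *v e) \<bullet> (transpose \<Delta> *v e))"
    unfolding lmi_M_def matrix_vector_mult_add_rdistrib inner_add_right XY
      scaleR_matrix_vector_assoc[symmetric] inner_scaleR_right ED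
    by (simp add: matrix_vector_mul_assoc[symmetric])
  have h21: "h \<bullet> ((transpose G\<^sub>2 ** transpose X\<^sub>1) *v w) = w \<bullet> (X\<^sub>1 *v (G\<^sub>2 *v h))"
    by (metis inner_commute inner_matrix_vector_transpose matrix_vector_mul_assoc
        matrix_transpose_mul)
  have r31: "r \<bullet> ((transpose R\<^sub>Q ** P) *v w) = r \<bullet> r"
    by (simp only: r_def matrix_vector_mul_assoc)
  have py: "p \<bullet> y = - (w \<bullet> (E *v (D\<^sub>0 *v y)))"
    by (simp only: p_def e_def inner_minus_left inner_matrix_vector_transpose)
  have "stack_vec w (stack_vec h (stack_vec r p)) \<bullet>
     (sym_blocks4
      (lmi_M X\<^sub>1 E \<Delta> Y\<^sub>1 \<alpha> \<mu>)
      (transpose G\<^sub>2 ** transpose X\<^sub>1)  (- mat 1)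
      (transpose R\<^sub>Q ** P)              0          (- mat 1)
      Y\<^sub>1                               G\<^sub>2         0          (- (\<mu> *\<^sub>R mat 1)) *v
       stack_vec w (stack_vec h (stack_vec r p))) \<le> 0"
    using feasible
    by (simp only: sdp_feasible_def loewner_le_def pos_semidef_uminus_iff_quadratic)
  then have "w \<bullet> (lmi_M X\<^sub>1 E \<Delta> Y\<^sub>1 \<alpha> \<mu> *v w) - h \<bullet> h - r \<bullet> r - \<mu> * (p \<bullet> p)
      + 2 * (w \<bullet> (X\<^sub>1 *v (G\<^sub>2 *v h)) + r \<bullet> r + p \<bullet> y) \<le> 0"
    unfolding sym_blocks4_quadratic h21 r31
    by (simp add: uminus_matrix_vector_mult scaleR_matrix_vector_assoc[symmetric] matrix_vector_mult_0
        y_def inner_add_right)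
  moreover have "\<mu> * (p \<bullet> p) \<le> \<mu> * ((transpose \<Delta> *v e) \<bullet> (transpose \<Delta> *v e))"
    using D \<mu> by simp
  moreover have "w \<bullet> (X\<^sub>1 *v y) = w \<bullet> (X\<^sub>1 *v (Y\<^sub>1 *v w)) + w \<bullet> (X\<^sub>1 *v (G\<^sub>2 *v h))"
    by (simp add: y_def matrix_vector_right_distrib inner_add_right del: matrix_vector_mul_assoc)
  moreover have "w \<bullet> ((X\<^sub>1 - E ** D\<^sub>0) *v y) = w \<bullet> (X\<^sub>1 *v y) - w \<bullet> (E *v (D\<^sub>0 *v y))"
    by (simp add: matrix_vector_mult_diff_rdistrib inner_diff_right matrix_vector_mul_assoc)
  ultimately have "2 * (w \<bullet> ((X\<^sub>1 - E ** D\<^sub>0) *v y)) \<le> - \<alpha> * (w \<bullet> w)"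
    using hr unfolding M py by (simp add: algebra_simps)
  then show ?thesis
    by (simp add: y_def h_def)
qed

theorem theorem3:
  fixes A :: "real^('n::finite + 'r::finite)^'n"
    and B :: "real^'m^'n"
    and E :: "real^'q^'n"
    and f :: "real^'n \<Rightarrow> real^'n"
    and Z :: "real^'n \<Rightarrow> real^('n + 'r)"
    and Q :: "real^'n \<Rightarrow> real^'r"
    and t :: "'T::{finite,linorder} \<Rightarrow> real"
    and a b :: real
    and x x_dot :: "real \<Rightarrow> real^'n"
    and u :: "real \<Rightarrow> real^'m"
    and d :: "real \<Rightarrow> real^'q"
    and U\<^sub>0 :: "real^('T::{finite,linorder})^'m"
    and X\<^sub>1 :: "real^('T::{finite,linorder})^'n"
    and Z\<^sub>0 :: "real^('T::{finite,linorder})^('n + 'r)"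
    and D\<^sub>0 :: "real^('T::{finite,linorder})^'q"
    and \<Delta> :: "real^'p^'q"
    and R\<^sub>Q :: "real^'\<tau>^'n"
    and \<X> :: "(real^'n) set"
    and P :: "real^'n^'n"
    and Y\<^sub>1 :: "real^'n^('T::{finite,linorder})"
    and G\<^sub>2 :: "real^'r^('T::{finite,linorder})"
    and \<alpha> \<mu> :: real
    and K :: "real^('n + 'r)^'m"
  assumes f: "\<And>\<xi>. f \<xi> = A *v Z \<xi>"
    and Z: "\<And>\<xi>. Z \<xi> = stack_vec \<xi> (Q \<xi>)"
    and Z_C1: "continuously_differentiable Z"
    and Q_nonlinear: "\<And>j. \<not> linear (\<lambda>\<xi>. Q \<xi> $ j)"
    and sampling_times: "strict_mono t"
    and experiment_interval: "a < b" "\<And>i. t i \<in> {a..b}"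
    and derivative_samples:
      "\<And>i. (x has_vector_derivative x_dot (t i)) (at (t i) within {a..b})"
    and dynamics_samples:
      "\<And>i. x_dot (t i) = f (x (t i)) + B *v u (t i) + E *v d (t i)"
    and U\<^sub>0: "U\<^sub>0 = sample_matrix t u"
    and X\<^sub>1: "X\<^sub>1 = sample_matrix t x_dot"
    and Z\<^sub>0: "Z\<^sub>0 = sample_matrix t (\<lambda>\<theta>. Z (x \<theta>))"
    and D\<^sub>0: "D\<^sub>0 = sample_matrix t d"
    and D\<^sub>0_bound: "D\<^sub>0 \<in> disturbance_set \<Delta>"
    and Q_bound:
      "\<And>\<xi>. \<xi> \<in> \<X> \<Longrightarrow>
        transpose (jacobian Q (at \<xi>)) ** jacobian Q (at \<xi>) \<preceq> R\<^sub>Q ** transpose R\<^sub>Q"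
    and feasible: "sdp_feasible Z\<^sub>0 X\<^sub>1 E \<Delta> R\<^sub>Q P Y\<^sub>1 G\<^sub>2 \<alpha> \<mu>"
    and K: "K = U\<^sub>0 ** (Y\<^sub>1 ** matrix_inv P ||| G\<^sub>2)"
  shows "\<exists>P' \<beta>. pos_def P' \<and> 0 < \<beta> \<and>
    (\<forall>\<xi>\<in>\<X>.
      transpose ((A + B ** K) ** jacobian Z (at \<xi>)) ** matrix_inv P'
        + matrix_inv P' ** ((A + B ** K) ** jacobian Z (at \<xi>))
      \<preceq> - (\<beta> *\<^sub>R matrix_inv P'))"
proof -
  have P: "pos_def P" and \<alpha>: "0 < \<alpha>" and ZY: "Z\<^sub>0 ** Y\<^sub>1 = (P === 0)"
    and ZG: "Z\<^sub>0 ** G\<^sub>2 = (0 === mat 1)"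
    using feasible by (simp_all add: sdp_feasible_def)
  have inv: "invertible P" and trP: "transpose P = P"
    using P pos_def_invertible by (auto simp: pos_def_def symmetric_mat_def)
  let ?S = "matrix_inv P"
  have PS: "P *v (?S *v v) = v" for v
    using inv by (simp add: matrix_vector_mul_assoc matrix_inv_right)
  have trS: "transpose ?S = ?S"
    using inv trP by (rule matrix_inv_symmetric)
  obtain c where c: "0 < c" "\<And>w. w \<bullet> (P *v w) \<le> c * (w \<bullet> w)"
    using quadratic_form_bounded by blast
  \<comment> \<open>Chosen so that \<open>\<beta> * (w \<bullet> (P *v w)) \<le> \<alpha> * (w
    \<bullet> w)\<close>, uniformly over the set \<open>\<X>\<close>.\<close>
  define \<beta> where "\<beta> = \<alpha> / c"
  have \<beta>: "0 < \<beta>"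
    using \<alpha> c(1) by (simp add: \<beta>_def)
  \<comment> \<open>A sample matrix depends only on values at the sampling times, so
    \<open>x_dot\<close> may be replaced by the right-hand side of the dynamics.\<close>
  have "X\<^sub>1 = sample_matrix t (\<lambda>\<theta>. A *v Z (x \<theta>) + B *v u \<theta> + E *v d \<theta>)"
    by (simp add: X\<^sub>1 sample_matrix_def dynamics_samples f)
  then have X: "X\<^sub>1 = A ** Z\<^sub>0 + B ** U\<^sub>0 + E ** D\<^sub>0"
    by (simp only: sample_matrix_add sample_matrix_mult Z\<^sub>0 U\<^sub>0 D\<^sub>0)
  \<comment> \<open>The vector \<open>?g\<close> is mapped by \<open>Z\<^sub>0\<close> to the
    stacked vector and by \<open>U\<^sub>0\<close> to its image under \<open>K\<close>, so the data
    equation \<open>X\<close> eliminates the unknown \<open>A\<close> and \<open>B\<close>.\<close>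
  have closed_loop: "(A + B ** K) *v stack_vec v h
      = (X\<^sub>1 - E ** D\<^sub>0) *v (Y\<^sub>1 *v (?S *v v) + G\<^sub>2 *v h)" for v h
  proof -
    let ?g = "Y\<^sub>1 *v (?S *v v) + G\<^sub>2 *v h"
    have "Z\<^sub>0 *v ?g = (Z\<^sub>0 ** Y\<^sub>1) *v (?S *v v) + (Z\<^sub>0 ** G\<^sub>2) *v h"
      by (simp only: matrix_vector_right_distrib matrix_vector_mul_assoc matrix_mul_assoc)
    also have "\<dots> = stack_vec v h"
      by (simp only: ZY ZG vcat_mult_vec PS matrix_vector_mult_0 stack_vec_add
          matrix_vector_mul_lid add_0_left add_0_right)
    finally have Zg: "Z\<^sub>0 *v ?g = stack_vec v h" .
    have Kg: "K *v stack_vec v h = U\<^sub>0 *v ?g"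
      by (simp only: K matrix_vector_mul_assoc[symmetric] hcat_mult_stack_vec)
    have "X\<^sub>1 - E ** D\<^sub>0 = A ** Z\<^sub>0 + B ** U\<^sub>0"
      by (simp add: X)
    then show ?thesis
      by (simp only: matrix_vector_mult_add_rdistrib matrix_vector_mul_assoc[symmetric] Zg Kg)
  qed
  have "transpose ((A + B ** K) ** jacobian Z (at \<xi>)) ** ?S
        + ?S ** ((A + B ** K) ** jacobian Z (at \<xi>)) \<preceq> - (\<beta> *\<^sub>R ?S)" if "\<xi> \<in> \<X>" for \<xi>
  proof -
    define F where "F = (A + B ** K) ** jacobian Z (at \<xi>)"
    have sym: "symmetric_mat (- (\<beta> *\<^sub>R ?S) - (transpose F ** ?S + ?S ** F))"
      by (simp add: symmetric_mat_def transpose_diff transpose_uminus transpose_add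
          matrix_transpose_mul trS transpose_scalar add.commute)
    have "0 \<le> v \<bullet> ((- (\<beta> *\<^sub>R ?S) - (transpose F ** ?S + ?S ** F)) *v v)" for v
    proof -
      define w where "w = ?S *v v"
      have v: "v = P *v w"
        by (simp only: w_def PS)
      have "F *v v = (A + B ** K) *v stack_vec v (jacobian Q (at \<xi>) *v v)"
        using Z_C1 jacobian_stack_vec[of Z Q, OF Z]
        by (simp add: F_def matrix_vector_mul_assoc[symmetric] continuously_differentiable_def
            del: matrix_vector_mul_assoc)
      also have "\<dots> = (X\<^sub>1 - E ** D\<^sub>0) *v (Y\<^sub>1 *v w + G\<^sub>2 *v (jacobian Q (at \<xi>) *v (P *v w)))"
        by (simp only: closed_loop w_def PS)
      finally have "2 * (w \<bullet> (F *v v)) \<le> - \<alpha> * (w \<bullet> w)"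
        using sdp_feasible_decay[OF feasible D\<^sub>0_bound Q_bound[OF that]] by simp
      moreover have "\<beta> * (v \<bullet> w) \<le> \<alpha> * (w \<bullet> w)"
      proof -
        have "\<beta> * (v \<bullet> w) \<le> \<beta> * (c * (w \<bullet> w))"
          using c(2)[of w] \<beta> by (simp add: v inner_commute)
        then show ?thesis
          using c(1) by (simp add: \<beta>_def)
      qed
      moreover have "v \<bullet> ((transpose F ** ?S) *v v) = w \<bullet> (F *v v)"
        by (metis inner_commute inner_matrix_vector_transpose matrix_vector_mul_assoc w_def)
      moreover have "v \<bullet> ((?S ** F) *v v) = w \<bullet> (F *v v)"
        by (metis inner_matrix_vector_transpose matrix_vector_mul_assoc trS w_def)
      ultimately show ?thesis
        by (simp add: matrix_vector_mult_diff_rdistrib matrix_vector_mult_add_rdistrib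
            uminus_matrix_vector_mult scaleR_matrix_vector_assoc[symmetric] inner_diff_right inner_add_right
            w_def[symmetric])
    qed
    with sym show ?thesis
      by (simp add: loewner_le_def pos_semidef_def F_def)
  qed
  \<comment> \<open>The witness \<open>P'\<close> is the \<open>P\<close> of the feasible
    program.\<close>
  with P \<beta> show ?thesis by blast
qed

end
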